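(* There exists a string family on which $\ell = \Omega(r\log n/\log\log n)$. That is, there is an infinite set $\mathcal{F}$ of strings such that $\ell(w)=\Omega\big(r(w)\log n/\log\log n\big)$ for $w\in\mathcal{F}$, where $n=|w|$.
   Context: A string family is an infinite set of finite strings of unbounded length; asymptotic notation on a family refers to strings $w$ of the family with $n=|w|\to\infty$ (with constants uniform over the family). $w[i:j]$ denotes the substring of $w$ from position $i$ to position $j$ (positions start at 1). L-systems: an L-system is a tuple $(\Sigma,\varphi,\tau,s,d,n)$, where $\Sigma$ is a finite alphabet, $\varphi:\Sigma^*\to\Sigma^*$ is a non-erasing monoid endomorphism (each rule $a\to\varphi(a)$, $a\in\Sigma$, has $|\varphi(a)|\ge 1$), $\tau:\Sigma^*\to\Sigma^*$ is a coding (a morphism with $|\tau(a)|=1$ for all $a\in\Sigma$), $s\in\Sigma^+$ is the axiom, and $d\ge 0$, $n\ge 1$ are integers. It generates the unique string $\tau(\varphi^d(s))[1:n]$ of length $n$. It is always assumed that $d=n^{O(1)}$ and $|\Sigma|=n^{O(1)}$ (each value fits in an $O(\log n)$-bit word). The size of the L-system is $\sum_{a\in\Sigma}|\varphi(a)|+|s|+|\Sigma|+2$. The measure $\ell(w)$ is the size of the smallest L-system generating $w$. Burrows-Wheeler transform: $BWT(w)$ is the string obtained by sorting all $|w|$ rotations of $w$ lexicographically and concatenating their last symbols in that order. $r(w)$ is the number of maximal runs of equal symbols in $BWT(w)$. *)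

theory Defs
  imports
    Complex_Main
    "HOL-Library.List_Lexorder"
    "HOL-Library.Landau_Symbols"
begin

subsection \<open>L-systems\<close>

text \<open>
  The morphisms of an L-system are given by their values on single symbols; only the values on
  the alphabet matter.
\<close>

record 'a lsystem =
  alphabet :: "'a set"
  rules :: "'a \<Rightarrow> 'a list"
  coding :: "'a \<Rightarrow> 'a"
  axiom_word :: "'a list"
  level :: nat
  len :: nat

definition morphism_ext :: "('a \<Rightarrow> 'a list) \<Rightarrow> 'a list \<Rightarrow> 'a list" where
  "morphism_ext f w = concat (map f w)"

definition lsystem :: "'a lsystem \<Rightarrow> bool" where
  "lsystem L \<longleftrightarrow>
     finite (alphabet L) \<and>
     (\<forall>a\<in>alphabet L. rules L a \<noteq> [] \<and> set (rules L a) \<subseteq> alphabet L) \<and>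
     (\<forall>a\<in>alphabet L. coding L a \<in> alphabet L) \<and>
     axiom_word L \<noteq> [] \<and> set (axiom_word L) \<subseteq> alphabet L \<and>
     1 \<le> len L"

definition unfolded :: "'a lsystem \<Rightarrow> 'a list" where
  "unfolded L = map (coding L) ((morphism_ext (rules L) ^^ level L) (axiom_word L))"

text \<open>
  The generated string must have length exactly \<open>len L\<close>. Since \<open>take\<close> also accepts
  shorter lists, the length condition is explicit.
\<close>

definition generates :: "'a lsystem \<Rightarrow> 'a list \<Rightarrow> bool" where
  "generates L w \<longleftrightarrow> len L \<le> length (unfolded L) \<and> w = take (len L) (unfolded L)"

definition lsize :: "'a lsystem \<Rightarrow> nat" where
  "lsize L = (\<Sum>a\<in>alphabet L. length (rules L a)) + length (axiom_word L) + card (alphabet L) + 2"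

text \<open>
  The standing assumption that the level and the alphabet size are $n^{O(1)}$, with the hidden
  constants made explicit as \<open>C\<close> and \<open>c\<close>.
\<close>

definition poly_bounded :: "nat \<Rightarrow> nat \<Rightarrow> 'a lsystem \<Rightarrow> bool" where
  "poly_bounded C c L \<longleftrightarrow> level L \<le> C * len L ^ c \<and> card (alphabet L) \<le> C * len L ^ c"

text \<open>
  Symbols are natural numbers: every finite ordered alphabet embeds, and fresh symbols are always
  available for the alphabet of an L-system. For nonempty \<open>w\<close> and positive \<open>C\<close>, \<open>c\<close> the minimum
  is over a nonempty set (see \<open>ell_attained\<close>); otherwise its value is meaningless.
\<close>

definition ell :: "nat \<Rightarrow> nat \<Rightarrow> nat list \<Rightarrow> nat" where
  "ell C c w = (LEAST k. \<exists>L :: nat lsystem.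
     lsystem L \<and> poly_bounded C c L \<and> generates L w \<and> lsize L = k)"

lemma ell_attained:
  assumes "w \<noteq> []" "1 \<le> C" "1 \<le> c"
  shows "\<exists>L :: nat lsystem. lsystem L \<and> poly_bounded C c L \<and> generates L w \<and> lsize L = ell C c w"
proof -
  define L :: "nat lsystem" where
    "L = \<lparr>alphabet = set w, rules = (\<lambda>a. [a]), coding = id, axiom_word = w, level = 0,
          len = length w\<rparr>"
  have n: "1 \<le> length w"
    using assms(1) by (cases w) auto
  have "card (set w) \<le> length w ^ 1"
    by (simp add: card_length)
  also have "\<dots> \<le> length w ^ c"
    using n assms(3) by (rule power_increasing[rotated])
  also have "\<dots> \<le> C * length w ^ c"
    using assms(2) by simp
  finally have "poly_bounded C c L"
    by (simp add: poly_bounded_def L_def)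
  moreover have "lsystem L" "generates L w"
    using assms(1) n by (auto simp: lsystem_def generates_def unfolded_def L_def)
  ultimately have "\<exists>k. \<exists>L :: nat lsystem.
      lsystem L \<and> poly_bounded C c L \<and> generates L w \<and> lsize L = k"
    by blast
  then show ?thesis
    unfolding ell_def by (rule LeastI_ex)
qed

subsection \<open>Burrows-Wheeler transform\<close>

text \<open>
  \<open>sort\<close> uses the lexicographic order on lists. Equal rotations are kept with multiplicity.
\<close>

definition bwt :: "'a::linorder list \<Rightarrow> 'a list" where
  "bwt w = map last (sort (map (\<lambda>i. rotate i w) [0..<length w]))"

text \<open>\<open>remdups_adj\<close> collapses each maximal run of equal symbols to a single symbol.\<close>

definition bwt_runs :: "'a::linorder list \<Rightarrow> nat" where
  "bwt_runs w = length (remdups_adj (bwt w))"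

subsection \<open>String families\<close>

definition string_family :: "'a list set \<Rightarrow> bool" where
  "string_family F \<longleftrightarrow> infinite F \<and> (\<forall>m. \<exists>w\<in>F. m \<le> length w)"

text \<open>
  The filter of strings of the family whose length tends to infinity, so that the constants in
  Landau notation are uniform over the family.
\<close>

definition along :: "'a list set \<Rightarrow> 'a list filter" where
  "along F = inf (filtercomap length at_top) (principal F)"

lemma eventually_along:
  "eventually P (along F) \<longleftrightarrow> (\<exists>n0. \<forall>w\<in>F. n0 \<le> length w \<longrightarrow> P w)"
  by (auto simp: along_def eventually_inf_principal eventually_filtercomap
      eventually_at_top_linorder)

end

theory Submission
  imports Defs "HOL-Library.Multiset"
begin

text \<open>
  The proof is a counting argument. Take \<open>n = 2 ^ m\<close> and \<open>m = 2 ^ t\<close>. A binary string with only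
  \<open>m\<close> ones has at most \<open>2 * m + 1\<close> runs in its BWT, because the BWT permutes the symbols. There
  are \<open>n choose m\<close> of these strings, about \<open>2 ^ (m * m)\<close>, whereas an L-system of size \<open>k\<close> is
  described, up to renaming of its alphabet, by its level and \<open>O(k)\<close> numbers below \<open>k\<close>. Hence
  some such string needs \<open>k * log k\<close> of order \<open>m * m\<close>. As \<open>m\<close> tends to infinity, allowing all
  levels below \<open>n ^ t\<close> costs only \<open>m * t\<close> bits and covers every polynomial bound at once.
\<close>

section \<open>Runs of the Burrows-Wheeler transform\<close>

text \<open>Before sorting, the last symbols of the rotations, listed by shift, spell a rotation of
  \<open>w\<close>; sorting only permutes them.\<close>

lemma mset_bwt: "mset (bwt w) = mset w"
proof -
  let ?n = "length w"
  have eq: "map (\<lambda>i. last (rotate i w)) [0..<?n] = rotate (?n - 1) w"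
  proof (rule nth_equalityI)
    fix i assume "i < length (map (\<lambda>i. last (rotate i w)) [0..<?n])"
    then have i: "i < ?n" by simp
    then have ne: "rotate i w \<noteq> []" by auto
    show "map (\<lambda>i. last (rotate i w)) [0..<?n] ! i = rotate (?n - 1) w ! i"
      using i ne by (simp add: last_conv_nth nth_rotate add.commute)
  qed simp
  have "mset (rotate i w) = mset w" for i
    by (metis add.commute append_take_drop_id mset_append rotate_drop_take)
  with arg_cong[OF eq, of mset] show ?thesis
    by (simp add: bwt_def multiset.map_comp comp_def)
qed

text \<open>Charge to each symbol other than \<open>a\<close> the run it may open and a run of
  \<open>a\<close> right after it. Only an initial run of \<open>a\<close> stays uncharged; tracking
  it separately makes the induction close.\<close>

lemma length_remdups_adj_le_hd:
  "length (remdups_adj xs) \<le>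
     2 * length (filter (\<lambda>x. x \<noteq> a) xs) + (if xs \<noteq> [] \<and> hd xs = a then 1 else 0)"
  by (induction xs rule: remdups_adj.induct) (auto split: if_splits | blast)+

lemma length_remdups_adj_le:
  "length (remdups_adj xs) \<le> 2 * length (filter (\<lambda>x. x \<noteq> a) xs) + 1"
  using length_remdups_adj_le_hd[of xs a] by (auto split: if_splits)

lemma bwt_runs_le: "bwt_runs w \<le> 2 * length (filter (\<lambda>x. x \<noteq> a) w) + 1"
proof -
  have "length (filter (\<lambda>x. x \<noteq> a) (bwt w)) = length (filter (\<lambda>x. x \<noteq> a) w)"
    by (metis mset_bwt mset_filter size_mset)
  then show ?thesis
    using length_remdups_adj_le[of "bwt w" a] by (simp add: bwt_runs_def)
qed

section \<open>Counting L-systems\<close>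

text \<open>The 0 separates blocks, and the shift by \<open>Suc\<close> keeps it distinct from all
  entries, so the blocks can be recovered.\<close>

definition flatten :: "nat list list \<Rightarrow> nat list" where
  "flatten xss = concat (map (\<lambda>xs. 0 # map Suc xs) xss)"

lemma takeWhile_map_Suc_flatten:
  "takeWhile (\<lambda>x. x \<noteq> 0) (map Suc xs @ flatten xss) = map Suc xs"
  "dropWhile (\<lambda>x. x \<noteq> 0) (map Suc xs @ flatten xss) = flatten xss"
  by (cases xss; simp add: flatten_def takeWhile_append dropWhile_append comp_def)+

lemma inj_flatten: "inj flatten"
proof (rule injI)
  show "flatten xss = flatten yss \<Longrightarrow> xss = yss" for xss yss
  proof (induction xss arbitrary: yss)
    case Nil
    then show ?case by (cases yss) (auto simp: flatten_def)
  next
    case (Cons xs xss)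
    then obtain ys zss where yss: "yss = ys # zss"
      by (cases yss) (auto simp: flatten_def)
    have eq: "map Suc xs @ flatten xss = map Suc ys @ flatten zss"
      using Cons.prems by (simp add: yss flatten_def)
    then have "map Suc xs = map Suc ys" "flatten xss = flatten zss"
      by (metis takeWhile_map_Suc_flatten)+
    then show ?case
      using Cons.IH by (simp add: yss inj_map_eq_map)
  qed
qed

text \<open>The factor 2 makes room for the separators and the coding table of an L-system of size
  \<open>K\<close>.\<close>

definition programs :: "nat \<Rightarrow> nat list list set" where
  "programs K = {p. set (flatten p) \<subseteq> {..K} \<and> length (flatten p) \<le> 2 * K}"

lemma finite_programs: "finite (programs K)"
  and card_programs_le: "card (programs K) \<le> (K + 2) ^ (2 * K)"
proof -
  let ?S = "{xs. set xs \<subseteq> {..K} \<and> length xs \<le> 2 * K}"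
  have fin: "finite ?S" by (rule finite_lists_length_le) simp
  have sub: "flatten ` programs K \<subseteq> ?S" by (auto simp: programs_def)
  have inj: "inj_on flatten (programs K)" using inj_flatten by (rule inj_on_subset) simp
  show "finite (programs K)"
    using sub fin inj by (meson finite_imageD finite_subset)
  have geo: "(\<Sum>i\<le>n. a ^ i) \<le> (a + 1) ^ n" for a n :: nat
  proof (induction n)
    case (Suc n)
    have "a ^ n \<le> (a + 1) ^ n" by (rule power_mono) auto
    then have "a * a ^ n \<le> a * (a + 1) ^ n" by simp
    from add_mono[OF Suc this] show ?case by simp
  qed simp
  have "card (programs K) \<le> card ?S"
    using inj sub fin by (rule card_inj_on_le)
  also have "\<dots> = (\<Sum>i\<le>2 * K. (K + 1) ^ i)"
    by (subst card_lists_length_le) auto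
  also have "\<dots> \<le> (K + 2) ^ (2 * K)"
    using geo[where a = "K + 1" and n = "2 * K"] by simp
  finally show "card (programs K) \<le> (K + 2) ^ (2 * K)" .
qed

text \<open>
  An L-system over the alphabet \<open>{..<m}\<close> is stored as the list of its axiom, the table of its
  coding, and its \<open>m\<close> rules.
\<close>

definition run :: "nat list list \<Rightarrow> nat \<Rightarrow> nat list" where
  "run p d = map (\<lambda>i. p ! 1 ! i) ((morphism_ext (\<lambda>i. p ! (i + 2)) ^^ d) (p ! 0))"

text \<open>This allows an arbitrary alphabet to be replaced by an initial segment of the naturals.
  Closure of \<open>A\<close> is carried through the induction because \<open>f'\<close> is
  controlled only on the image of \<open>A\<close>.\<close>

lemma morphism_ext_pow_rename:
  assumes closed: "\<And>a. a \<in> A \<Longrightarrow> set (f a) \<subseteq> A"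
    and ren: "\<And>a. a \<in> A \<Longrightarrow> f' (g a) = map g (f a)"
    and s: "set s \<subseteq> A"
  shows "set ((morphism_ext f ^^ d) s) \<subseteq> A \<and>
         (morphism_ext f' ^^ d) (map g s) = map g ((morphism_ext f ^^ d) s)"
proof (induction d)
  case (Suc d)
  let ?u = "(morphism_ext f ^^ d) s"
  have u: "set ?u \<subseteq> A" using Suc by simp
  have "map (f' \<circ> g) ?u = map (map g \<circ> f) ?u"
    using u ren by (intro map_cong) auto
  then have "morphism_ext f' (map g ?u) = map g (morphism_ext f ?u)"
    by (simp add: morphism_ext_def map_concat del: map_eq_conv)
  moreover have "set (morphism_ext f ?u) \<subseteq> A"
    using u closed by (fastforce simp: morphism_ext_def)
  ultimately show ?case using Suc by simp
qed (use s in simp)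

lemma generates_imp_program:
  assumes L: "lsystem L" and gen: "generates L w" and bin: "set w \<subseteq> {0, 1}"
  shows "\<exists>p \<in> programs (lsize L). w = take (len L) (run p (level L))"
proof -
  let ?A = "alphabet L"
  define m where "m = card ?A"
  have fin: "finite ?A" using L by (simp add: lsystem_def)
  obtain h where h: "bij_betw h {0..<m} ?A"
    using ex_bij_betw_nat_finite[OF fin] m_def by blast
  define g where "g = the_inv_into {0..<m} h"
  have g_lt: "g a < m" and hg: "h (g a) = a" if "a \<in> ?A" for a
    using that h the_inv_into_into[of h "{0..<m}" a "{0..<m}"]
    by (auto simp: g_def bij_betw_def f_the_inv_into_f)
  have h_in: "h i \<in> ?A" if "i < m" for i
    using that h by (auto simp: bij_betw_def)
  let ?rs = "map (\<lambda>i. map g (rules L (h i))) [0..<m]"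
  \<comment> \<open>The coding may use arbitrary symbols, but only those below 2 occur in \<open>w\<close>.\<close>
  let ?cs = "map (\<lambda>i. min 1 (coding L (h i))) [0..<m]"
  define p where "p = map g (axiom_word L) # ?cs # ?rs"
  have closed: "set (rules L a) \<subseteq> ?A" if "a \<in> ?A" for a
    using that L by (auto simp: lsystem_def)
  have ax: "set (axiom_word L) \<subseteq> ?A" using L by (auto simp: lsystem_def)
  let ?u = "(morphism_ext (rules L) ^^ level L) (axiom_word L)"
  have sim: "set ?u \<subseteq> ?A"
    "(morphism_ext (\<lambda>i. p ! (i + 2)) ^^ level L) (map g (axiom_word L)) = map g ?u"
    using morphism_ext_pow_rename[where A = ?A and f = "rules L" and g = g
        and s = "axiom_word L" and d = "level L" and f' = "\<lambda>i. p ! (i + 2)"]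
      closed ax g_lt hg by (auto simp: p_def)
  have "run p (level L) = map (\<lambda>i. p ! 1 ! i) (map g ?u)"
    using sim(2) by (simp add: run_def p_def)
  also have "\<dots> = map (min 1) (unfolded L)"
    using sim(1) g_lt hg by (auto simp: p_def unfolded_def)
  finally have run: "run p (level L) = map (min 1) (unfolded L)" .
  have "map (min 1) w = w"
    using bin by (intro map_idI) auto
  then have w: "w = take (len L) (run p (level L))"
    using gen unfolding generates_def run take_map by metis
  have sum_rules: "(\<Sum>i\<leftarrow>[0..<m]. length (rules L (h i))) = (\<Sum>a\<in>?A. length (rules L a))"
    using sum.reindex_bij_betw[OF h, of "\<lambda>a. length (rules L a)"]
    by (simp add: interv_sum_list_conv_sum_set_nat)
  \<comment> \<open>There are \<open>m + 2\<close> separators, one per block, and \<open>m\<close>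
    entries in the coding table.\<close>
  have "length (flatten p) = 2 + length (axiom_word L) + 2 * m + (\<Sum>a\<in>?A. length (rules L a))"
    unfolding sum_rules[symmetric]
    by (simp add: flatten_def p_def length_concat comp_def sum_list_Suc)
  then have len: "length (flatten p) \<le> 2 * lsize L"
    by (simp add: lsize_def m_def)
  have m_le: "m + 2 \<le> lsize L" by (simp add: lsize_def m_def)
  \<comment> \<open>The case \<open>x \<le> 1\<close> covers the truncated coding table, where an
    entry can equal \<open>m\<close> if \<open>m = 1\<close>.\<close>
  have "x < m + 2" if x: "xs \<in> set p" "x \<in> set xs" for xs x
  proof -
    consider a where "a \<in> ?A" "x = g a" | "x \<le> 1"
      using x ax closed[OF h_in] by (fastforce simp: p_def)
    then show ?thesis using g_lt by cases force+
  qed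
  then have "Suc x \<le> lsize L" if "xs \<in> set p" "x \<in> set xs" for xs x
    using that m_le by fastforce
  then have "set (flatten p) \<subseteq> {..lsize L}"
    by (auto simp: flatten_def)
  with len have "p \<in> programs (lsize L)" by (simp add: programs_def)
  then show ?thesis using w by blast
qed

lemma programs_mono: "K \<le> K' \<Longrightarrow> programs K \<subseteq> programs K'"
  by (force simp: programs_def)

text \<open>Pigeonhole: a word of length \<open>n\<close> generated by a small L-system is
  determined by a level below \<open>D\<close> and a program, since \<open>len L\<close> must equal
  \<open>n\<close>. There are fewer such pairs than \<open>k\<close>-subsets of the
  positions.\<close>

lemma exists_binary_word_hard:
  assumes "D * (K + 2) ^ (2 * K) < n choose k"
  shows "\<exists>w :: nat list. length w = n \<and> length (filter (\<lambda>x. x \<noteq> 0) w) = k \<and>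
    (\<forall>L. lsystem L \<and> generates L w \<and> level L < D \<longrightarrow> K < lsize L)"
proof -
  define chi :: "nat set \<Rightarrow> nat list" where
    "chi S = map (\<lambda>i. if i \<in> S then 1 else 0) [0..<n]" for S
  let ?Sub = "{S. S \<subseteq> {0..<n} \<and> card S = k}"
  let ?G = "(\<lambda>(d, p). take n (run p d)) ` ({..<D} \<times> programs K)"
  have inj: "inj_on chi ?Sub"
  proof (rule inj_onI)
    fix S T assume "S \<in> ?Sub" "T \<in> ?Sub" and "chi S = chi T"
    then have "i \<in> S \<longleftrightarrow> i \<in> T" if "i < n" for i
      using that by (auto simp: chi_def split: if_splits)
    with \<open>S \<in> ?Sub\<close> \<open>T \<in> ?Sub\<close> show "S = T" by auto
  qed
  have "card ?G \<le> card ({..<D} \<times> programs K)"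
    by (rule card_image_le) (simp add: finite_programs)
  also have "\<dots> \<le> D * (K + 2) ^ (2 * K)"
    using card_programs_le by (simp add: card_cartesian_product)
  also have "\<dots> < card (chi ` ?Sub)"
    using assms inj by (simp add: card_image n_subsets)
  finally have "\<not> chi ` ?Sub \<subseteq> ?G"
    by (meson card_mono finite_SigmaI finite_imageI finite_lessThan finite_programs leD)
  then obtain S where S: "S \<subseteq> {0..<n}" "card S = k" and hard: "chi S \<notin> ?G" by blast
  have "length (filter (\<lambda>x. x \<noteq> 0) (chi S)) = card {i. i < n \<and> chi S ! i \<noteq> 0}"
    by (simp add: length_filter_conv_card chi_def)
  also have "{i. i < n \<and> chi S ! i \<noteq> 0} = S"
    using S by (auto simp: chi_def split: if_splits)
  finally have ones: "length (filter (\<lambda>x. x \<noteq> 0) (chi S)) = k" using S by simp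
  have len: "length (chi S) = n" by (simp add: chi_def)
  have "K < lsize L" if L: "lsystem L" "generates L (chi S)" "level L < D" for L
  proof (rule ccontr)
    assume "\<not> K < lsize L"
    then have "programs (lsize L) \<subseteq> programs K" by (intro programs_mono) simp
    moreover have "set (chi S) \<subseteq> {0, 1}" by (auto simp: chi_def)
    ultimately obtain p where "p \<in> programs K" "chi S = take (len L) (run p (level L))"
      using generates_imp_program L by blast
    moreover have "len L = n"
      using L(2) len by (auto simp: generates_def)
    ultimately have "chi S \<in> ?G" using L(3) by force
    with hard show False ..
  qed
  then show ?thesis using ones len by blast
qed

section \<open>The family\<close>

text \<open>Compare exponents of 2. The choice of \<open>K\<close> gives programs at most
  \<open>4 * t * K \<le> m * m / 2\<close>, and levels take \<open>m * t\<close>. The binomial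
  coefficient supplies at least \<open>m * m - m * t\<close>, and the two terms \<open>m * t\<close>
  total less than \<open>m * m / 2\<close>.\<close>

lemma count_lt_binomial:
  fixes t :: nat
  assumes t: "6 \<le> t" and m: "m = 2 ^ t" and K: "K = m * m div (8 * t)"
  shows "2 ^ (m * t) * (K + 2) ^ (2 * K) < (2 ^ m choose m)"
proof -
  have big: "4 * (t * m) < m * m"
  proof -
    have "4 * t < 2 ^ t" using t
      by (induction t rule: dec_induct) auto
    then show ?thesis by (simp add: m)
  qed
  have m64: "64 \<le> m"
    using power_increasing[OF t, of "2::nat"] by (simp add: m)
  have Kt: "8 * t * K \<le> m * m" by (simp add: K)
  have "2 * K \<le> 8 * t * K" using t by (intro mult_right_mono) auto
  moreover have "64 * 64 \<le> m * m" using m64 by (intro mult_mono) auto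
  ultimately have "K + 2 \<le> m * m" using Kt by linarith
  also have "\<dots> = 2 ^ (2 * t)" by (simp add: m mult_2 power_add)
  finally have "(K + 2) ^ (2 * K) \<le> (2 ^ (2 * t)) ^ (2 * K)" by (intro power_mono) auto
  also have "\<dots> = 2 ^ (4 * t * K)" by (simp flip: power_mult)
  finally have 1: "2 ^ (m * t) * (K + 2) ^ (2 * K) \<le> 2 ^ (m * t + 4 * t * K)"
    by (simp add: power_add)
  have tm: "t < m" by (simp add: m)
  have expo: "m * t + 4 * t * K < (m - t) * m"
  proof -
    have "m * t + m * t + 4 * t * K < m * m" using big Kt unfolding mult.commute[of m t] by linarith
    then show ?thesis unfolding diff_mult_distrib mult.commute[of t m] by linarith
  qed
  have mle: "m \<le> 2 ^ m" by (simp add: less_imp_le)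
  \<comment> \<open>The bound is \<open>(n / m) ^ m\<close> with \<open>n = 2 ^ m\<close>; the
    quotient is an exact power of 2 because \<open>m\<close> is one.\<close>
  have "real (2 ^ m) / real m = 2 ^ (m - t)"
    using tm by (simp add: m power_diff)
  then have "(2 ^ (m - t)) ^ m \<le> real (2 ^ m choose m)"
    using binomial_ge_n_over_k_pow_k[OF mle, where 'a = real] by simp
  then have "real (2 ^ ((m - t) * m)) \<le> real (2 ^ m choose m)"
    by (simp add: power_mult)
  then have "2 ^ ((m - t) * m) \<le> (2 ^ m choose m)" by (simp only: of_nat_le_iff)
  moreover have "(2::nat) ^ (m * t + 4 * t * K) < 2 ^ ((m - t) * m)"
    using expo by (intro power_strict_increasing) auto
  ultimately show ?thesis using 1 by linarith
qed

theorem lemma4: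
  "\<exists>F :: nat list set. string_family F \<and>
     (\<forall>C::nat. \<forall>c::nat. 1 \<le> C \<and> 1 \<le> c \<longrightarrow>
        (\<lambda>w. real (ell C c w)) \<in> \<Omega>[along F](\<lambda>w.
          real (bwt_runs w) * log 2 (real (length w)) / log 2 (log 2 (real (length w)))))"
proof -
  define K :: "nat \<Rightarrow> nat" where "K t = 2 ^ t * 2 ^ t div (8 * t)" for t
  \<comment> \<open>With \<open>n = 2 ^ 2 ^ t\<close>, the level bound is \<open>n ^ t\<close>. It
    does not mention \<open>C\<close> or \<open>c\<close>, so one family serves all of them.\<close>
  define good where "good t w \<longleftrightarrow> length w = 2 ^ 2 ^ t \<and> length (filter (\<lambda>x. x \<noteq> 0) w) = 2 ^ t \<and>
    (\<forall>L. lsystem L \<and> generates L w \<and> level L < 2 ^ (2 ^ t * t) \<longrightarrow> K t < lsize L)"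
    for t and w :: "nat list"
  have ex: "\<exists>w. good t w" if "6 \<le> t" for t
    unfolding good_def K_def
    by (rule exists_binary_word_hard) (rule count_lt_binomial[OF that refl refl])
  define F where "F = {w. \<exists>t\<ge>6. good t w}"
  have long: "\<exists>w\<in>F. N \<le> length w" for N
  proof -
    obtain w where w: "good (N + 6) w" using ex by force
    have "N \<le> N + 6" by simp
    also have "N + 6 \<le> 2 ^ (N + 6)" by (intro less_imp_le less_exp)
    also have "\<dots> \<le> 2 ^ 2 ^ (N + 6)" by (intro less_imp_le less_exp)
    finally have "N \<le> length w" using w by (simp add: good_def)
    then show ?thesis using w by (auto simp: F_def intro!: exI[of _ "N + 6"])
  qed
  have "infinite F"
  proof
    assume "finite F"
    then obtain B where "\<forall>x\<in>length ` F. x \<le> B"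
      using finite_nat_set_iff_bounded_le[of "length ` F"] by auto
    then show False using long[of "Suc B"] by fastforce
  qed
  then have fam: "string_family F" using long by (simp add: string_family_def)
  have "(\<lambda>w. real (ell C c w)) \<in> \<Omega>[along F](\<lambda>w.
          real (bwt_runs w) * log 2 (real (length w)) / log 2 (log 2 (real (length w))))"
    if Cc: "1 \<le> C" "1 \<le> c" for C c :: nat
  \<comment> \<open>The 24 is 3 from \<open>bwt_runs w \<le> 3 * m\<close> times 8 from the
    denominator in \<open>K\<close>.\<close>
  proof (rule landau_omega.bigI[of "1 / 24"])
    show "\<forall>\<^sub>F w in along F. 1 / 24 * norm (real (bwt_runs w) * log 2 (real (length w)) /
          log 2 (log 2 (real (length w)))) \<le> norm (real (ell C c w))"
      unfolding eventually_along
    proof (intro exI ballI impI)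
      \<comment> \<open>The length threshold forces \<open>C + c \<le> t\<close>, whence
        \<open>C * n ^ c < n ^ t\<close> and the level of a minimal L-system falls in the range
        covered by \<open>good\<close>.\<close>
      fix w assume "w \<in> F" and n0: "2 ^ 2 ^ (C + c) \<le> length w"
      then obtain t where t: "6 \<le> t" and w: "good t w" by (auto simp: F_def)
      define m :: nat where "m = 2 ^ t"
      have len: "length w = 2 ^ m" using w by (simp add: good_def m_def)
      have tC: "C + c \<le> t" using n0 by (simp add: len m_def)
      have m1: "1 \<le> m" by (simp add: m_def)
      have "w \<noteq> []" using len by auto
      then obtain L :: "nat lsystem" where L: "lsystem L" "poly_bounded C c L" "generates L w"
        "lsize L = ell C c w"
        using ell_attained Cc by blast
      have "len L = 2 ^ m" using L(3) len by (auto simp: generates_def)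
      then have "level L \<le> C * 2 ^ (m * c)"
        using L(2) by (simp add: poly_bounded_def power_mult)
      also have "\<dots> < 2 ^ C * 2 ^ (m * c)" by simp
      also have "\<dots> \<le> 2 ^ (m * C) * 2 ^ (m * c)"
        using m1 by (intro mult_right_mono power_increasing) auto
      also have "\<dots> = 2 ^ (m * (C + c))" by (simp add: power_add distrib_left)
      also have "\<dots> \<le> 2 ^ (m * t)" using tC by (intro power_increasing) auto
      finally have "K t < ell C c w"
        using w L by (metis good_def m_def)
      \<comment> \<open>The strict inequality \<open>K t < ell C c w\<close> absorbs the rounding of
        \<open>div\<close>.\<close>
      then have "m * m \<le> 8 * t * ell C c w"
        using t dividend_less_times_div[of "8 * t" "m * m"]
          mult_le_mono2[of "Suc (K t)" "ell C c w" "8 * t"]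
        by (simp add: K_def flip: m_def)
      then have "real (m * m) \<le> real (8 * t * ell C c w)" by (simp only: of_nat_le_iff)
      then have key: "real m * real m / real t \<le> 8 * real (ell C c w)"
        using t by (simp add: field_simps)
      have "bwt_runs w \<le> 3 * m"
        using bwt_runs_le[of w 0] w m1 unfolding good_def m_def[symmetric] by linarith
      then have "real (bwt_runs w) * real m / real t \<le> 3 * real m * real m / real t"
        by (intro divide_right_mono mult_right_mono) auto
      also have "\<dots> = 3 * (real m * real m / real t)" by simp
      also have "\<dots> \<le> 24 * real (ell C c w)" using key by linarith
      finally have "real (bwt_runs w) * real m / real t \<le> 24 * real (ell C c w)" .
      moreover have "log 2 (real (length w)) = real m" by (simp add: len log_nat_power)
      moreover have "log 2 (real m) = real t" by (simp add: m_def log_nat_power)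
      ultimately show "1 / 24 * norm (real (bwt_runs w) * log 2 (real (length w)) /
          log 2 (log 2 (real (length w)))) \<le> norm (real (ell C c w))"
        by simp
    qed
  qed simp
  with fam show ?thesis by blast
qed

end
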